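(* Let $N=2$ or $N=3$. Suppose $u\in\mathcal{C}^2(\overline{\mathbb{R}^N_+})$ solves $$-\Delta u=u-1\ \text{ in }\mathbb{R}^N_+,\qquad u=0\ \text{ on }\partial\mathbb{R}^N_+,$$ and that for every $M>0$ there exists $C(M)>0$ such that $0\le u(x)\le C(M)$ for all $x\in\mathbb{R}^{N-1}\times[0,M]$. Then $$u(x',x_N)=1-\cos x_N .$$
   Context: $\mathbb{R}^N_+:=\mathbb{R}^{N-1}\times(0,+\infty)$, and its points are written $x=(x',x_N)$ with $x'\in\mathbb{R}^{N-1}$. *)

theory Defs
  imports "HOL-Analysis.Analysis"
begin

text \<open>Points of the half-space are pairs (x', x_N). The library gives the product type the
  Euclidean norm, and its \<open>Basis\<close> consists of the N coordinate directions.\<close>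

definition half_space :: "('a::euclidean_space \<times> real) set"
  where "half_space = UNIV \<times> {0<..}"

definition partial :: "'a::euclidean_space \<Rightarrow> ('a \<Rightarrow> real) \<Rightarrow> 'a \<Rightarrow> real"
  where "partial b f x = deriv (\<lambda>t. f (x + t *\<^sub>R b)) 0"

definition has_partials_on :: "('a::euclidean_space \<Rightarrow> real) \<Rightarrow> 'a set \<Rightarrow> bool"
  where "has_partials_on f \<Omega> \<longleftrightarrow>
    (\<forall>b\<in>Basis. \<forall>x\<in>\<Omega>. (\<lambda>t. f (x + t *\<^sub>R b)) differentiable (at 0))"

definition laplacian :: "('a::euclidean_space \<Rightarrow> real) \<Rightarrow> 'a \<Rightarrow> real"
  where "laplacian f x = (\<Sum>b\<in>Basis. partial b (partial b f) x)"

definition extends_continuously :: "('a::euclidean_space \<Rightarrow> real) \<Rightarrow> 'a set \<Rightarrow> bool"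
  where "extends_continuously f \<Omega> \<longleftrightarrow>
    (\<exists>g. continuous_on (closure \<Omega>) g \<and> (\<forall>x\<in>\<Omega>. g x = f x))"

text \<open>For open \<open>\<Omega>\<close>: membership in \<open>C\<^sup>2\<close> of the closure of \<open>\<Omega>\<close>, i.e. \<open>u\<close> is continuous on the
  closure, its partial derivatives of order one and two exist in \<open>\<Omega>\<close>, and they extend continuously
  to the closure. The values of \<open>u\<close> outside the closure play no role.\<close>

definition C2_closure :: "'a::euclidean_space set \<Rightarrow> ('a \<Rightarrow> real) \<Rightarrow> bool"
  where "C2_closure \<Omega> u \<longleftrightarrow>
    continuous_on (closure \<Omega>) u \<and>
    has_partials_on u \<Omega> \<and>
    (\<forall>i\<in>Basis. extends_continuously (partial i u) \<Omega> \<and>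
       has_partials_on (partial i u) \<Omega> \<and>
       (\<forall>j\<in>Basis. extends_continuously (partial j (partial i u)) \<Omega>))"

end

theory Submission
  imports Defs
begin

text \<open>Subtract the expected solution: \<open>w = u - (1 - cos x\<^sub>N)\<close> solves \<open>\<Delta>w + w = 0\<close>, vanishes on the
  boundary, is bounded on strips, and satisfies \<open>w \<ge> cos x\<^sub>N - 1\<close> because \<open>u \<ge> 0\<close>. The lower bound
  is \<open>0\<close> exactly at the heights \<open>T = 2\<pi>n\<close>, and the proof is driven by these heights. Everything
  is read off the functions \<open>V\<^sub>k(x') = \<integral>\<^sub>0\<^sup>T w(x', t) sin(kt) dt\<close>, which are bounded on
  \<open>\<real>\<^sup>N\<^sup>-\<^sup>1\<close>. Two integrations by parts in \<open>t\<close> give, with \<open>\<Delta>'\<close> the Laplacian in \<open>x'\<close>,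
  \<open>\<Delta>'V\<^sub>k = (k\<^sup>2 - 1) V\<^sub>k - [w\<^sub>t sin(kT) - k w cos(kT)]\<close>, the bracket being taken at height \<open>T\<close>;
  the boundary condition removes the contribution of height \<open>0\<close> (\<open>laplacian_sine_integral\<close>).

  For \<open>k = 1\<close> this says \<open>\<Delta>'V\<^sub>1 = w(\<cdot>, T) \<ge> 0\<close>. A bounded subharmonic function in dimension one or
  two is constant, so \<open>w(\<cdot>, T) = 0\<close>
  (\<open>bounded_subharmonic_imp_harmonic_dim_le_2\<close>); this is where \<open>N \<le> 3\<close> enters. Hence \<open>u\<close>
  attains its minimum \<open>0\<close> at every point of height \<open>T\<close>, and \<open>w\<^sub>t(\<cdot>, T) = 0\<close> as well.

  For \<open>k > 1\<close> the bracket is now zero and \<open>\<Delta>'V\<^sub>k = (k\<^sup>2 - 1) V\<^sub>k\<close> with a positive factor, whose only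
  bounded solution is \<open>0\<close> (\<open>bounded_screened_harmonic_eq_0\<close>). So for each \<open>x'\<close> the sine transform
  of \<open>w(x', \<cdot>)\<close> restricted to \<open>[0, T]\<close> vanishes for all frequencies above \<open>1\<close>. That transform is
  analytic in the frequency, so the function is zero (\<open>sine_integrals_determine\<close>). As \<open>T\<close> can be
  taken arbitrarily large, \<open>w = 0\<close>.\<close>

section \<open>Directional derivatives and radial comparison functions\<close>
definition has_dir_deriv :: "'a::real_normed_vector \<Rightarrow> ('a \<Rightarrow> real) \<Rightarrow> ('a \<Rightarrow> real) \<Rightarrow> bool"
  where "has_dir_deriv b f f' \<longleftrightarrow> (\<forall>x. ((\<lambda>s. f (x + s *\<^sub>R b)) has_real_derivative f' x) (at 0))"

lemma has_dir_deriv_along_line: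
  assumes "has_dir_deriv b f f'"
  shows "((\<lambda>s. f (x + s *\<^sub>R b)) has_real_derivative f' (x + s *\<^sub>R b)) (at s)"
proof -
  have "((\<lambda>r. f (x + s *\<^sub>R b + r *\<^sub>R b)) has_real_derivative f' (x + s *\<^sub>R b)) (at 0)"
    using assms by (simp add: has_dir_deriv_def)
  then have "((\<lambda>r. f (x + (r + s) *\<^sub>R b)) has_real_derivative f' (x + s *\<^sub>R b)) (at 0)"
    by (simp add: scaleR_left_distrib add_ac)
  then show ?thesis
    using DERIV_shift[of "\<lambda>s. f (x + s *\<^sub>R b)" _ 0 s] by simp
qed

lemma second_derivative_nonpos_at_max:
  fixes F F1 :: "real \<Rightarrow> real"
  assumes d1: "\<And>s. (F has_real_derivative F1 s) (at s)"
    and d2: "(F1 has_real_derivative c) (at 0)"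
    and max: "\<And>s. F s \<le> F 0"
  shows "c \<le> 0"
proof (rule ccontr)
  assume "\<not> c \<le> 0"
  moreover have "F1 0 = 0"
    using DERIV_local_max[OF d1[of 0], of 1] max by simp
  ultimately obtain d where d: "d > 0" "\<And>h. 0 < h \<Longrightarrow> h < d \<Longrightarrow> 0 < F1 h"
    using DERIV_pos_inc_right[OF d2] by auto
  have "F 0 < F (d / 2)"
  proof (rule DERIV_pos_imp_increasing_open[where f = F])
    show "\<exists>y. (F has_real_derivative y) (at x) \<and> 0 < y" if "0 < x" "x < d / 2" for x
      using d1[of x] d(2)[of x] that d(1) by force
    show "continuous_on {0..d / 2} F"
      by (meson d1 DERIV_isCont continuous_at_imp_continuous_on)
  qed (use d in auto)
  with max[of "d / 2"] show False by simp
qed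

text \<open>Adding a radial penalty that tends to infinity restores the attained maximum which a function
  bounded above on the whole space may lack. At the maximum every second directional derivative of
  the difference is nonpositive, and summing over an orthonormal basis compares the two Laplacians;
  \<open>4qH'' + 2dH'\<close> is the Laplacian of \<open>H(|x - x\<^sub>0|\<^sup>2)\<close> at \<open>q = |x - x\<^sub>0|\<^sup>2\<close> in dimension \<open>d\<close>.\<close>
lemma maximum_with_radial_penalty:
  fixes V :: "'a::euclidean_space \<Rightarrow> real"
  assumes cont: "continuous_on UNIV V" and bdd: "\<And>x. V x \<le> C"
    and V1: "\<And>b. b \<in> Basis \<Longrightarrow> has_dir_deriv b V (V1 b)"
    and V2: "\<And>b. b \<in> Basis \<Longrightarrow> has_dir_deriv b (V1 b) (V2 b)"
    and H1: "\<And>q. q \<ge> 0 \<Longrightarrow> (H has_real_derivative H1 q) (at q)"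
    and H2: "\<And>q. q \<ge> 0 \<Longrightarrow> (H1 has_real_derivative H2 q) (at q)"
    and Hlim: "filterlim H at_top at_top" and e: "\<epsilon> > 0"
  obtains p where "\<And>x. V x - \<epsilon> * H ((norm (x - x0))\<^sup>2) \<le> V p - \<epsilon> * H ((norm (p - x0))\<^sup>2)"
    and "(\<Sum>b\<in>Basis. V2 b p) \<le> \<epsilon> * (4 * (norm (p - x0))\<^sup>2 * H2 ((norm (p - x0))\<^sup>2)
            + 2 * real DIM('a) * H1 ((norm (p - x0))\<^sup>2))"
proof -
  define F where "F = (\<lambda>x. V x - \<epsilon> * H ((norm (x - x0))\<^sup>2))"
  have Hcont: "continuous_on {0..} H"
    by (meson H1 DERIV_isCont atLeast_iff continuous_at_imp_continuous_on)
  have contF: "continuous_on UNIV F"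
    unfolding F_def
    by (intro continuous_intros cont continuous_on_compose2[OF Hcont]) auto
  have "filterlim (\<lambda>x. norm (x - x0)) at_top at_infinity"
  proof (rule filterlim_at_top_mono)
    show "filterlim (\<lambda>x. - norm x0 + norm x) at_top at_infinity"
      by (intro filterlim_tendsto_add_at_top[OF tendsto_const] filterlim_norm_at_top)
    show "\<forall>\<^sub>F x in at_infinity. - norm x0 + norm x \<le> norm (x - x0)"
      using norm_triangle_ineq2[of _ x0] by (intro always_eventually) (simp add: algebra_simps)
  qed
  then have "filterlim (\<lambda>x. H ((norm (x - x0))\<^sup>2)) at_top at_infinity"
    by (intro filterlim_compose[OF Hlim] filterlim_pow_at_top) auto
  then have "\<forall>\<^sub>F x in at_infinity. (C - F x0) / \<epsilon> \<le> H ((norm (x - x0))\<^sup>2)"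
    unfolding filterlim_at_top by blast
  then obtain R where R: "\<And>x. R \<le> norm x \<Longrightarrow> (C - F x0) / \<epsilon> \<le> H ((norm (x - x0))\<^sup>2)"
    unfolding eventually_at_infinity by blast
  have far: "F x \<le> F x0" if "R \<le> norm x" for x
    using R[OF that] e bdd[of x] by (simp add: F_def field_simps)
  obtain p where "p \<in> cball 0 (max R (norm x0))"
    and p: "\<And>x. x \<in> cball 0 (max R (norm x0)) \<Longrightarrow> F x \<le> F p"
    using continuous_attains_sup[of "cball 0 (max R (norm x0))" F]
      continuous_on_subset[OF contF]
    by (metis compact_cball cball_eq_empty le_max_iff_disj norm_ge_zero not_le subset_UNIV)
  have pmax: "F x \<le> F p" for x
  proof (cases "norm x \<le> max R (norm x0)")
    case True then show ?thesis using p by simp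
  next
    case False
    then have "F x \<le> F x0" using far by simp
    also have "\<dots> \<le> F p" using p by simp
    finally show ?thesis .
  qed
  let ?q = "(norm (p - x0))\<^sup>2"
  have second: "V2 b p \<le> \<epsilon> * (4 * ((p - x0) \<bullet> b)\<^sup>2 * H2 ?q + 2 * H1 ?q)" if b: "b \<in> Basis" for b
  proof -
    define Q where "Q = (\<lambda>s. (norm (p + s *\<^sub>R b - x0))\<^sup>2)"
    define Q1 where "Q1 = (\<lambda>s. 2 * (((p - x0) \<bullet> b) + s))"
    have Q: "Q s = ?q + 2 * s * ((p - x0) \<bullet> b) + s\<^sup>2" for s
    proof -
      have "p + s *\<^sub>R b - x0 = (p - x0) + s *\<^sub>R b" by simp
      show ?thesis
        unfolding Q_def \<open>p + s *\<^sub>R b - x0 = (p - x0) + s *\<^sub>R b\<close>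
        using b dot_norm[of "p - x0" "s *\<^sub>R b"] by (simp add: power_mult_distrib)
    qed
    have dQ: "(Q has_real_derivative Q1 s) (at s)" for s
      unfolding Q Q1_def by (auto intro!: derivative_eq_intros)
    have dQ1: "(Q1 has_real_derivative 2) (at s)" for s
      unfolding Q1_def by (auto intro!: derivative_eq_intros)
    have Qpos: "Q s \<ge> 0" for s by (simp add: Q_def)
    have dH: "((\<lambda>s. H (Q s)) has_real_derivative H1 (Q s) * Q1 s) (at s)" for s
      by (rule DERIV_chain2[OF H1[OF Qpos] dQ])
    have dH1: "((\<lambda>s. H1 (Q s)) has_real_derivative H2 (Q s) * Q1 s) (at s)" for s
      by (rule DERIV_chain2[OF H2[OF Qpos] dQ])
    let ?F1 = "\<lambda>s. V1 b (p + s *\<^sub>R b) - \<epsilon> * (H1 (Q s) * Q1 s)"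
    have "V2 b p - \<epsilon> * (H2 (Q 0) * Q1 0 * Q1 0 + H1 (Q 0) * 2) \<le> 0"
    proof (rule second_derivative_nonpos_at_max)
      show "((\<lambda>s. F (p + s *\<^sub>R b)) has_real_derivative ?F1 s) (at s)" for s
        unfolding F_def Q_def[symmetric]
        using has_dir_deriv_along_line[OF V1[OF b]] dH[unfolded Q_def]
        by (auto intro!: derivative_eq_intros simp: Q_def)
      show "(?F1 has_real_derivative V2 b p - \<epsilon> * (H2 (Q 0) * Q1 0 * Q1 0 + H1 (Q 0) * 2)) (at 0)"
        using V2[OF b] dH1[of 0] dQ1[of 0] unfolding has_dir_deriv_def
        by (auto intro!: derivative_eq_intros)
      show "F (p + s *\<^sub>R b) \<le> F (p + 0 *\<^sub>R b)" for s using pmax by simp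
    qed
    then show ?thesis
      using e by (simp add: Q Q1_def power2_eq_square algebra_simps)
  qed
  have "(\<Sum>b\<in>Basis. V2 b p) \<le> (\<Sum>b\<in>(Basis::'a set). \<epsilon> * (4 * ((p - x0) \<bullet> b)\<^sup>2 * H2 ?q + 2 * H1 ?q))"
    by (intro sum_mono second)
  also have "\<dots> = \<epsilon> * (4 * (\<Sum>b\<in>Basis. ((p - x0) \<bullet> b)\<^sup>2) * H2 ?q + 2 * real DIM('a) * H1 ?q)"
    by (simp add: sum.distrib sum_distrib_left sum_distrib_right distrib_left mult_ac)
  also have "(\<Sum>b\<in>Basis. ((p - x0) \<bullet> b)\<^sup>2) = ?q"
    unfolding power2_norm_eq_inner by (simp add: euclidean_inner[of "p - x0" "p - x0"] power2_eq_square)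
  finally show thesis
    using that[of p] pmax by (simp add: F_def)
qed

section \<open>Liouville theorems\<close>

text \<open>The penalty is \<open>\<epsilon>|y - x|\<^sup>2\<close>, centred at the point \<open>x\<close> of interest so that it costs nothing
  there: \<open>V x\<close> is at most the value of \<open>V\<close> at the penalised maximum, where \<open>l V \<le> 2\<epsilon>d\<close>.\<close>
lemma bounded_screened_harmonic_nonpos:
  fixes V :: "'a::euclidean_space \<Rightarrow> real"
  assumes cont: "continuous_on UNIV V" and bdd: "\<And>x. V x \<le> C"
    and V1: "\<And>b. b \<in> Basis \<Longrightarrow> has_dir_deriv b V (V1 b)"
    and V2: "\<And>b. b \<in> Basis \<Longrightarrow> has_dir_deriv b (V1 b) (V2 b)"
    and eq: "\<And>x. (\<Sum>b\<in>Basis. V2 b x) = l * V x" and l: "l > 0"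
  shows "V x \<le> 0"
proof (rule field_le_epsilon)
  fix e :: real assume e: "e > 0"
  let ?d = "2 * real DIM('a)"
  define \<epsilon> where "\<epsilon> = e * l / ?d"
  have \<epsilon>: "\<epsilon> > 0" using e l by (simp add: \<epsilon>_def)
  obtain p where p: "\<And>y. V y - \<epsilon> * (norm (y - x))\<^sup>2 \<le> V p - \<epsilon> * (norm (p - x))\<^sup>2"
    and lap: "(\<Sum>b\<in>Basis. V2 b p) \<le> \<epsilon> * (4 * (norm (p - x))\<^sup>2 * 0 + ?d * 1)"
    by (rule maximum_with_radial_penalty[OF cont bdd V1 V2, of "\<lambda>q. q" "\<lambda>_. 1" "\<lambda>_. 0" \<epsilon> x])
      (use \<epsilon> filterlim_ident in auto)
  have "V x \<le> V p - \<epsilon> * (norm (p - x))\<^sup>2" using p[of x] by simp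
  also have "\<dots> \<le> V p" using \<epsilon> by simp
  also have "\<dots> \<le> \<epsilon> * ?d / l" using lap l by (simp add: eq field_simps)
  also have "\<dots> = e" using l by (simp add: \<epsilon>_def)
  finally show "V x \<le> 0 + e" by simp
qed

lemma bounded_screened_harmonic_eq_0:
  fixes V :: "'a::euclidean_space \<Rightarrow> real"
  assumes cont: "continuous_on UNIV V" and bdd: "\<And>x. \<bar>V x\<bar> \<le> C"
    and V1: "\<And>b. b \<in> Basis \<Longrightarrow> has_dir_deriv b V (V1 b)"
    and V2: "\<And>b. b \<in> Basis \<Longrightarrow> has_dir_deriv b (V1 b) (V2 b)"
    and eq: "\<And>x. (\<Sum>b\<in>Basis. V2 b x) = l * V x" and l: "l > 0"
  shows "V x = 0"
proof (rule antisym)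
  show "V x \<le> 0"
    using abs_le_D1[OF bdd] by (rule bounded_screened_harmonic_nonpos[OF cont _ V1 V2 eq l])
  have "- V x \<le> 0"
  proof (rule bounded_screened_harmonic_nonpos[of "\<lambda>x. - V x" C "\<lambda>b x. - V1 b x" "\<lambda>b x. - V2 b x" l])
    show "continuous_on UNIV (\<lambda>x. - V x)" using cont by (rule continuous_on_minus)
    show "- V x \<le> C" for x using abs_le_D2[OF bdd] .
    show "(\<Sum>b\<in>Basis. - V2 b x) = l * - V x" for x using eq[of x] by (simp add: sum_negf)
  qed (use V1 V2 l in \<open>auto simp: has_dir_deriv_def intro: DERIV_minus\<close>)
  then show "0 \<le> V x" by simp
qed

text \<open>The penalty is \<open>log(1 + log(1 + k r\<^sup>2))\<close>. It is unbounded, but grows so slowly that in dimension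
  at most two its Laplacian is negative as soon as \<open>k r\<^sup>2 \<ge> 3\<close>, while it never exceeds \<open>4k\<close>. A
  subharmonic function can therefore have its penalised maximum only close to the centre \<open>x\<^sub>0\<close>, and
  there \<open>f \<le> 4k\<epsilon>\<close>. If \<open>f x\<^sub>0\<close> were positive, a large \<open>k\<close> would force the maximum into a
  neighbourhood where \<open>f > f x\<^sub>0 / 2\<close>, and then a small \<open>\<epsilon>\<close> gives a contradiction. No such
  penalty exists in dimension three, where \<open>-1 / sqrt (1 + r\<^sup>2)\<close> is a bounded subharmonic function
  that is not harmonic.\<close>
lemma bounded_subharmonic_imp_harmonic_dim_le_2:
  fixes V :: "'a::euclidean_space \<Rightarrow> real"
  assumes dim: "DIM('a) \<le> 2"
    and cont: "continuous_on UNIV V" and bdd: "\<And>x. V x \<le> C"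
    and V1: "\<And>b. b \<in> Basis \<Longrightarrow> has_dir_deriv b V (V1 b)"
    and V2: "\<And>b. b \<in> Basis \<Longrightarrow> has_dir_deriv b (V1 b) (V2 b)"
    and eq: "\<And>x. (\<Sum>b\<in>Basis. V2 b x) = f x"
    and contf: "continuous_on UNIV f" and nonneg: "\<And>x. f x \<ge> 0"
  shows "f x0 = 0"
proof (rule ccontr)
  assume "f x0 \<noteq> 0"
  then have f0: "f x0 > 0" using nonneg[of x0] by simp
  obtain \<delta> where \<delta>: "\<delta> > 0" and near: "\<And>x. norm (x - x0) < \<delta> \<Longrightarrow> dist (f x) (f x0) < f x0 / 2"
    using contf f0 unfolding continuous_on_iff dist_norm by (metis UNIV_I half_gt_zero)
  \<comment> \<open>With this \<open>k\<close>, the region \<open>k r\<^sup>2 < 3\<close> lies inside the ball of radius \<open>\<delta>\<close>;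
    the value of \<open>\<epsilon>\<close> below makes \<open>4k\<epsilon>\<close> smaller than \<open>f x0 / 2\<close>.\<close>
  define k where "k = 4 / \<delta>\<^sup>2"
  have k: "k > 0" using \<delta> by (simp add: k_def)
  define \<epsilon> where "\<epsilon> = f x0 / (16 * k)"
  have \<epsilon>: "\<epsilon> > 0" using f0 k by (simp add: \<epsilon>_def)
  define L where "L = (\<lambda>q. 1 + ln (1 + k * q))"
  define H where "H = (\<lambda>q. ln (L q))"
  define H1 where "H1 = (\<lambda>q. k / ((1 + k * q) * L q))"
  define H2 where "H2 = (\<lambda>q. - (k\<^sup>2 * (1 + L q)) / ((1 + k * q) * L q)\<^sup>2)"
  have L: "L q \<ge> 1" "1 + k * q > 0" if "q \<ge> 0" for q
    using that k by (auto simp: L_def intro: add_pos_nonneg)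
  have dL: "(L has_real_derivative k / (1 + k * q)) (at q)" if "q \<ge> 0" for q
    unfolding L_def using L[OF that] by (auto intro!: derivative_eq_intros)
  have dH: "(H has_real_derivative H1 q) (at q)" if "q \<ge> 0" for q
    unfolding H_def H1_def using L[OF that] dL[OF that] by (auto intro!: derivative_eq_intros)
  have dH1: "(H1 has_real_derivative H2 q) (at q)" if "q \<ge> 0" for q
  proof -
    have "((\<lambda>q. (1 + k * q) * L q) has_real_derivative k * L q + k / (1 + k * q) * (1 + k * q)) (at q)"
      using dL[OF that] by (auto intro!: derivative_eq_intros)
    also have "k / (1 + k * q) * (1 + k * q) = k"
      using L[OF that] by (intro nonzero_eq_divide_eq[THEN iffD1, OF _ refl]) simp
    also have "k * L q + k = k * (1 + L q)" by (simp add: distrib_left)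
    finally have P: "((\<lambda>q. (1 + k * q) * L q) has_real_derivative k * (1 + L q)) (at q)" .
    show ?thesis
      using DERIV_divide[OF DERIV_const P, of k] L[OF that]
      unfolding H1_def H2_def by (simp add: power2_eq_square mult.assoc)
  qed
  have Hlim: "filterlim H at_top at_top"
    unfolding H_def L_def using k
    by (intro filterlim_compose[OF ln_at_top] filterlim_tendsto_add_at_top[OF tendsto_const]
      filterlim_tendsto_pos_mult_at_top[OF tendsto_const _ filterlim_ident])
  obtain p where
    lap: "(\<Sum>b\<in>Basis. V2 b p) \<le> \<epsilon> * (4 * (norm (p - x0))\<^sup>2 * H2 ((norm (p - x0))\<^sup>2)
            + 2 * real DIM('a) * H1 ((norm (p - x0))\<^sup>2))"
    by (rule maximum_with_radial_penalty[OF cont bdd V1 V2 dH dH1 Hlim \<epsilon>])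
  define q where "q = (norm (p - x0))\<^sup>2"
  have q: "q \<ge> 0" by (simp add: q_def)
  define D where "D = ((1 + k * q) * L q)\<^sup>2"
  have D: "D \<ge> 1"
    using L[OF q] k q unfolding D_def by (intro one_le_power) (simp add: mult_ge1_I)
  \<comment> \<open>Since \<open>H\<close> is increasing, the planar case is the worst one.\<close>
  have "2 * real DIM('a) * H1 q \<le> 4 * H1 q"
    using dim L[OF q] k by (intro mult_right_mono) (auto simp: H1_def)
  then have "4 * q * H2 q + 2 * real DIM('a) * H1 q \<le> 4 * q * H2 q + 4 * H1 q"
    by simp
  also have "\<dots> = 4 * k * (L q - k * q) / D"
  proof -
    have "H1 q = k * ((1 + k * q) * L q) / D"
      using L[OF q] unfolding H1_def D_def by (simp add: power2_eq_square)
    moreover have "H2 q = - (k\<^sup>2 * (1 + L q)) / D" by (simp add: H2_def D_def)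
    ultimately have "4 * q * H2 q + 4 * H1 q
        = (4 * q * - (k\<^sup>2 * (1 + L q)) + 4 * (k * ((1 + k * q) * L q))) / D"
      by (simp add: add_divide_distrib diff_divide_distrib)
    then show ?thesis by (simp add: algebra_simps power2_eq_square)
  qed
  finally have "4 * q * H2 q + 2 * real DIM('a) * H1 q \<le> 4 * k * (L q - k * q) / D" .
  then have fp: "f p \<le> \<epsilon> * (4 * k * (L q - k * q) / D)"
    using lap \<epsilon> unfolding eq q_def[symmetric] by (meson mult_left_mono less_imp_le order_trans)
  show False
  proof (cases "k * q \<ge> 3")
    case True
    have "1 + k * q < exp (k * q - 1)"
    proof -
      define y where "y = k * q - 1"
      have y: "y \<ge> 2" using True by (simp add: y_def)
      have "1 + y + y\<^sup>2 / 2 \<le> exp y" using y by (intro exp_lower_Taylor_quadratic) auto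
      moreover have "y * y \<ge> 2 * 2" using y by (intro mult_mono) auto
      ultimately show ?thesis by (simp add: y_def[symmetric] power2_eq_square) (simp add: y_def)
    qed
    then have "ln (1 + k * q) < k * q - 1"
      using L(2)[OF q] by (metis ln_exp ln_less_cancel_iff exp_gt_zero)
    then have "L q - k * q < 0" by (simp add: L_def)
    then have "\<epsilon> * (4 * k * (L q - k * q) / D) < 0"
      using \<epsilon> k D by (simp add: mult_pos_neg divide_neg_pos)
    then show False using fp nonneg[of p] by simp
  next
    case False
    have "L q - k * q \<le> 1" using ln_add_one_self_le_self[of "k * q"] k q by (simp add: L_def)
    then have "4 * k * (L q - k * q) \<le> 4 * k * 1" using k by (intro mult_left_mono) auto
    also have "\<dots> \<le> 4 * k * D" using k D by (intro mult_left_mono) auto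
    finally have "4 * k * (L q - k * q) / D \<le> 4 * k" using D by (simp add: field_simps)
    then have "\<epsilon> * (4 * k * (L q - k * q) / D) \<le> \<epsilon> * (4 * k)"
      using \<epsilon> by (intro mult_left_mono) auto
    with fp have "f p \<le> \<epsilon> * (4 * k)" by simp
    also have "\<dots> < f x0 / 2" using k f0 by (simp add: \<epsilon>_def)
    finally have 1: "f p < f x0 / 2" .
    have "q < 3 / 4 * \<delta>\<^sup>2" using False \<delta> unfolding k_def by (simp add: field_simps)
    also have "\<dots> < \<delta>\<^sup>2" using \<delta> by simp
    finally have "q < \<delta>\<^sup>2" .
    then have "norm (p - x0) < \<delta>"
      unfolding q_def using \<delta> by (intro power2_less_imp_less[of _ \<delta>]) auto
    then have "\<bar>f p - f x0\<bar> < f x0 / 2" using near by (simp add: dist_real_def)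
    then show False using 1 by linarith
  qed
qed

section \<open>Integration over vertical fibres\<close>

text \<open>The identity \<open>f(x + sb, t) = f(x - b, t) + \<integral>\<^sub>-\<^sub>1\<^sup>s p(x + rb, t) dr\<close> holds for \<open>t > 0\<close> and both sides
  are continuous down to \<open>t = 0\<close>, so tangential differentiability passes to the boundary. This is
  what makes differentiation under the integral over the closed fibre \<open>[0, T]\<close> legitimate.\<close>
lemma has_dir_deriv_boundary:
  fixes f p :: "'a::real_normed_vector \<times> real \<Rightarrow> real"
  assumes contf: "continuous_on (UNIV \<times> {0..}) f" and contp: "continuous_on (UNIV \<times> {0..}) p"
    and d: "\<And>t. t > 0 \<Longrightarrow> has_dir_deriv b (\<lambda>x. f (x, t)) (\<lambda>x. p (x, t))"
    and t: "t \<ge> 0"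
  shows "has_dir_deriv b (\<lambda>x. f (x, t)) (\<lambda>x. p (x, t))"
proof (cases "t = 0")
  case False then show ?thesis using d t by simp
next
  case True
  show ?thesis
    unfolding has_dir_deriv_def
  proof
    fix x
    let ?I = "\<lambda>s t. integral {-1..s} (\<lambda>r. p (x + r *\<^sub>R b, t))"
    have lim: "((\<lambda>n. inverse (real (Suc n))) \<longlonglongrightarrow> 0)" by (rule LIMSEQ_inverse_real_of_nat)
    have eq: "f (x + s *\<^sub>R b, 0) = f (x - b, 0) + ?I s 0" if "s \<ge> -1" for s
    proof -
      let ?D = "\<lambda>t. f (x + s *\<^sub>R b, t) - f (x - b, t) - ?I s t"
      have "continuous_on {0..} ?D"
      proof (intro continuous_intros)
        have "continuous_on ({0..} \<times> cbox (-1) s) (\<lambda>(t, r). p (x + r *\<^sub>R b, t))"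
          unfolding case_prod_unfold
          by (intro continuous_on_compose2[OF contp] continuous_intros) auto
        then show "continuous_on {0..} (?I s)"
          using integral_continuous_on_param[of "{0..}" "-1" s "\<lambda>t r. p (x + r *\<^sub>R b, t)"]
          by simp
      qed (intro continuous_on_compose2[OF contf] continuous_intros; auto)+
      moreover have "?D t = 0" if "t > 0" for t
      proof -
        have "((\<lambda>r. p (x + r *\<^sub>R b, t)) has_integral f (x + s *\<^sub>R b, t) - f (x + (-1) *\<^sub>R b, t)) {-1..s}"
          using \<open>s \<ge> -1\<close> has_dir_deriv_along_line[OF d[OF that]]
          by (intro fundamental_theorem_of_calculus)
            (auto simp: has_real_derivative_iff_has_vector_derivative[symmetric]
              intro: has_field_derivative_at_within)
        then show ?thesis by (simp add: integral_unique)
      qed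
      ultimately have "?D 0 = 0"
        using continuous_on_tendsto_compose[of "{0..}" ?D, OF _ lim]
        by (intro LIMSEQ_unique[of "\<lambda>n. ?D (inverse (real (Suc n)))" "?D 0" 0]) auto
      then show ?thesis by simp
    qed
    have "((\<lambda>s. ?I s 0) has_real_derivative p (x + 0 *\<^sub>R b, 0)) (at 0 within {-1..1})"
      by (rule integral_has_real_derivative)
        (auto intro!: continuous_on_compose2[OF contp] continuous_intros)
    then have "((\<lambda>s. ?I s 0) has_real_derivative p (x, 0)) (at 0)"
      by (simp add: at_within_Icc_at)
    then have "((\<lambda>s. f (x - b, 0) + ?I s 0) has_real_derivative p (x, 0)) (at 0)"
      using DERIV_add[OF DERIV_const] by fastforce
    then show "((\<lambda>s. f (x + s *\<^sub>R b, t)) has_real_derivative p (x, t)) (at 0)"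
      unfolding True
      by (rule has_field_derivative_transform_within_open[of _ _ _ "{-1<..}"]) (use eq in auto)
  qed
qed

definition fibre_integral ::
    "real \<Rightarrow> (real \<Rightarrow> real) \<Rightarrow> ('a \<times> real \<Rightarrow> real) \<Rightarrow> 'a \<Rightarrow> real"
  where "fibre_integral T g f x = integral {0..T} (\<lambda>t. f (x, t) * g t)"

lemma continuous_on_fibre_integral:
  fixes f :: "'a::real_normed_vector \<times> real \<Rightarrow> real"
  assumes contf: "continuous_on (UNIV \<times> {0..}) f" and contg: "continuous_on UNIV g"
  shows "continuous_on UNIV (fibre_integral T g f)"
proof -
  have "continuous_on (UNIV \<times> cbox 0 T) (\<lambda>(x, t). f (x, t) * g t)"
    unfolding case_prod_unfold
    by (intro continuous_on_compose2[OF contf] continuous_on_compose2[OF contg] continuous_intros) auto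
  then show ?thesis
    using integral_continuous_on_param[of UNIV 0 T "\<lambda>x t. f (x, t) * g t"]
    by (simp add: fibre_integral_def[abs_def])
qed

lemma has_dir_deriv_fibre_integral:
  fixes f p :: "'a::real_normed_vector \<times> real \<Rightarrow> real"
  assumes contf: "continuous_on (UNIV \<times> {0..}) f" and contp: "continuous_on (UNIV \<times> {0..}) p"
    and d: "\<And>t. t > 0 \<Longrightarrow> has_dir_deriv b (\<lambda>x. f (x, t)) (\<lambda>x. p (x, t))"
    and contg: "continuous_on UNIV g"
  shows "has_dir_deriv b (fibre_integral T g f) (fibre_integral T g p)"
  unfolding has_dir_deriv_def
proof
  fix x
  let ?F = "\<lambda>s t. f (x + s *\<^sub>R b, t) * g t"
  let ?P = "\<lambda>s t. p (x + s *\<^sub>R b, t) * g t"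
  have "((\<lambda>s. integral (cbox 0 T) (?F s)) has_field_derivative integral (cbox 0 T) (?P 0)) (at 0 within UNIV)"
  proof (rule leibniz_rule_field_derivative)
    show "((\<lambda>s. ?F s t) has_real_derivative ?P s t) (at s within UNIV)" if "t \<in> cbox 0 T" for s t
    proof -
      have "has_dir_deriv b (\<lambda>x. f (x, t)) (\<lambda>x. p (x, t))"
        using that by (intro has_dir_deriv_boundary[OF contf contp d]) auto
      then show ?thesis
        by (intro DERIV_cmult_right) (rule has_dir_deriv_along_line)
    qed
    show "?F s integrable_on cbox 0 T" for s
      by (intro integrable_continuous continuous_on_compose2[OF contf]
          continuous_on_compose2[OF contg] continuous_intros) auto
    show "continuous_on (UNIV \<times> cbox 0 T) (\<lambda>(s, t). ?P s t)"
      unfolding case_prod_unfold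
      by (intro continuous_on_compose2[OF contp] continuous_on_compose2[OF contg] continuous_intros) auto
  qed auto
  then show "((\<lambda>s. fibre_integral T g f (x + s *\<^sub>R b)) has_real_derivative fibre_integral T g p x) (at 0)"
    by (simp add: fibre_integral_def)
qed

section \<open>Uniqueness for the truncated sine transform\<close>

text \<open>Vanishing on an interval of frequencies can be differentiated in the frequency. Two derivatives
  multiply the integrand by \<open>-t\<^sup>2\<close>, so \<open>h(t) sin(kt)\<close> is orthogonal to every polynomial in \<open>t\<^sup>2\<close>.
  These are dense in the continuous functions on \<open>[0, T]\<close>, so \<open>h(t) sin(kt) = 0\<close>, and for given
  \<open>t > 0\<close> some admissible \<open>k\<close> has \<open>sin(kt) = 1\<close>.\<close>
lemma sine_integrals_determine:
  fixes h :: "real \<Rightarrow> real"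
  assumes cont: "continuous_on {0..T} h"
    and zero: "\<And>k. k > a \<Longrightarrow> integral {0..T} (\<lambda>t. h t * sin (k * t)) = 0"
    and t: "0 < t" "t \<le> T"
  shows "h t = 0"
proof -
  have deriv: "((\<lambda>k. integral {0..T} (\<lambda>t. h t * t ^ n * f (k * t))) has_real_derivative
      integral {0..T} (\<lambda>t. h t * t ^ Suc n * f' (k * t))) (at k)"
    if f: "\<And>y. (f has_real_derivative f' y) (at y)" and f': "continuous_on UNIV f'"
    for f f' :: "real \<Rightarrow> real" and n k
  proof -
    have contf: "continuous_on UNIV f"
      by (meson f DERIV_isCont continuous_at_imp_continuous_on)
    have "((\<lambda>k. integral (cbox 0 T) (\<lambda>t. h t * t ^ n * f (k * t))) has_field_derivative
      integral (cbox 0 T) (\<lambda>t. h t * t ^ Suc n * f' (k * t))) (at k within UNIV)"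
    proof (rule leibniz_rule_field_derivative)
      show "((\<lambda>k. h t * t ^ n * f (k * t)) has_real_derivative h t * t ^ Suc n * f' (k * t)) (at k within UNIV)"
        for k t by (auto intro!: derivative_eq_intros DERIV_chain2[OF f])
      show "(\<lambda>t. h t * t ^ n * f (k * t)) integrable_on cbox 0 T" for k
        by (intro integrable_continuous continuous_intros continuous_on_compose2[OF cont]
            continuous_on_compose2[OF contf]) auto
      show "continuous_on (UNIV \<times> cbox 0 T) (\<lambda>(k, t). h t * t ^ Suc n * f' (k * t))"
        unfolding case_prod_unfold
        by (intro continuous_intros continuous_on_compose2[OF cont]
            continuous_on_compose2[OF f']) auto
    qed auto
    then show ?thesis by simp
  qed
  have vanish: "integral {0..T} (\<lambda>t. h t * t ^ Suc n * f' (k * t)) = 0"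
    if f: "\<And>y. (f has_real_derivative f' y) (at y)" and f': "continuous_on UNIV f'"
      and z: "\<And>k. k > a \<Longrightarrow> integral {0..T} (\<lambda>t. h t * t ^ n * f (k * t)) = 0" and k: "k > a"
    for f f' :: "real \<Rightarrow> real" and n k
  proof (rule DERIV_unique)
    show "((\<lambda>k. integral {0..T} (\<lambda>t. h t * t ^ n * f (k * t))) has_real_derivative
        integral {0..T} (\<lambda>t. h t * t ^ Suc n * f' (k * t))) (at k)"
      by (rule deriv[OF f f'])
    show "((\<lambda>k. integral {0..T} (\<lambda>t. h t * t ^ n * f (k * t))) has_real_derivative 0) (at k)"
      by (rule has_field_derivative_transform_within_open[OF DERIV_const[of 0], of "{a<..}"])
        (use z k in auto)
  qed
  have even: "integral {0..T} (\<lambda>t. h t * t ^ (2 * j) * sin (k * t)) = 0" if "k > a" for j k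
    using that
  proof (induction j arbitrary: k)
    case 0 then show ?case using zero by simp
  next
    case (Suc j)
    have "integral {0..T} (\<lambda>t. h t * t ^ Suc (2 * j) * cos (k * t)) = 0" if "k > a" for k
      by (rule vanish[where f = sin]) (use Suc.IH that in \<open>auto intro: DERIV_sin continuous_intros\<close>)
    then have "integral {0..T} (\<lambda>t. h t * t ^ Suc (Suc (2 * j)) * (- sin (k * t))) = 0"
      using Suc.prems
      by (intro vanish[where f = cos and f' = "\<lambda>y. - sin y"])
        (auto intro: DERIV_cos intro!: continuous_intros)
    then show ?case by simp
  qed
  have hs: "h s * sin (k * s) = 0" if k: "k > a" and s: "s \<in> {0..T}" for k s
  proof -
    define G where "G = (\<lambda>t. h t * sin (k * t))"
    have contG: "continuous_on {0..T} G"
      unfolding G_def by (intro continuous_intros cont)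
    have poly: "integral {0..T} (\<lambda>t. G t * q (t\<^sup>2)) = 0" and qint: "(\<lambda>t. G t * q (t\<^sup>2)) integrable_on {0..T}"
      if q: "real_polynomial_function q" for q
    proof -
      obtain c n where q_eq: "q = (\<lambda>x. \<Sum>i\<le>n. c i * x ^ i)"
        using q unfolding real_polynomial_function_iff_sum by blast
      have e: "(\<lambda>t. G t * q (t\<^sup>2)) = (\<lambda>t. \<Sum>i\<le>n. c i * (h t * t ^ (2 * i) * sin (k * t)))"
        unfolding q_eq G_def sum_distrib_left power_mult by (simp only: mult_ac)
      have int: "(\<lambda>t. c i * (h t * t ^ (2 * i) * sin (k * t))) integrable_on {0..T}" for i
        by (intro integrable_continuous_interval continuous_intros cont)
      show "(\<lambda>t. G t * q (t\<^sup>2)) integrable_on {0..T}"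
        unfolding e by (intro integrable_sum int) auto
      show "integral {0..T} (\<lambda>t. G t * q (t\<^sup>2)) = 0"
        unfolding e using even[OF k] by (subst integral_sum[OF _ int]) (auto simp del: power_mult)
    qed
    have Gint: "(\<lambda>t. G t * G t) integrable_on {0..T}" "(\<lambda>t. \<bar>G t\<bar>) integrable_on {0..T}"
      by (intro integrable_continuous_interval continuous_intros contG)+
    have "integral {0..T} (\<lambda>t. G t * G t) \<le> 0"
    proof (rule field_le_epsilon)
      fix e :: real assume e: "e > 0"
      define A where "A = integral {0..T} (\<lambda>t. \<bar>G t\<bar>)"
      have A: "A \<ge> 0" unfolding A_def by (rule integral_nonneg[OF Gint(2)]) simp
      \<comment> \<open>Weierstrass is applied in the variable \<open>y = t\<^sup>2\<close>, as only even powers of \<open>t\<close> go with the sine.\<close>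
      have "continuous_on {0..T\<^sup>2} (\<lambda>y. G (sqrt y))"
        by (intro continuous_on_compose2[OF contG] continuous_intros)
          (use t in \<open>auto intro!: real_le_lsqrt\<close>)
      then obtain q where q: "real_polynomial_function q"
        and near: "\<And>y. y \<in> {0..T\<^sup>2} \<Longrightarrow> \<bar>G (sqrt y) - q y\<bar> < e / (A + 1)"
        using Stone_Weierstrass_real_polynomial_function[of "{0..T\<^sup>2}" "\<lambda>y. G (sqrt y)" "e / (A + 1)"] e A
        by auto
      have "integral {0..T} (\<lambda>t. G t * G t) = integral {0..T} (\<lambda>t. G t * G t - G t * q (t\<^sup>2))"
        using poly[OF q] by (simp add: integral_diff[OF Gint(1) qint[OF q]])
      also have "\<dots> \<le> integral {0..T} (\<lambda>t. \<bar>G t\<bar> * (e / (A + 1)))"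
      proof (rule integral_le)
        show "(\<lambda>t. G t * G t - G t * q (t\<^sup>2)) integrable_on {0..T}"
          by (intro integrable_diff Gint(1) qint[OF q])
        show "(\<lambda>t. \<bar>G t\<bar> * (e / (A + 1))) integrable_on {0..T}"
          by (intro integrable_on_mult_left Gint(2))
        show "G r * G r - G r * q (r\<^sup>2) \<le> \<bar>G r\<bar> * (e / (A + 1))" if r: "r \<in> {0..T}" for r
        proof -
          have "\<bar>G r - q (r\<^sup>2)\<bar> \<le> e / (A + 1)"
            using near[of "r\<^sup>2"] r by (auto simp: power_mono)
          then have "\<bar>G r\<bar> * \<bar>G r - q (r\<^sup>2)\<bar> \<le> \<bar>G r\<bar> * (e / (A + 1))"
            by (intro mult_left_mono) auto
          moreover have "G r * (G r - q (r\<^sup>2)) \<le> \<bar>G r\<bar> * \<bar>G r - q (r\<^sup>2)\<bar>"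
            by (metis abs_ge_self abs_mult)
          ultimately show ?thesis by (simp add: right_diff_distrib)
        qed
      qed
      also have "\<dots> = A * (e / (A + 1))" by (simp add: A_def)
      also have "\<dots> \<le> 0 + e" using A e by (simp add: field_simps)
      finally show "integral {0..T} (\<lambda>t. G t * G t) \<le> 0 + e" .
    qed
    moreover have "integral {0..T} (\<lambda>t. G t * G t) \<ge> 0"
      by (rule integral_nonneg[OF Gint(1)]) simp
    ultimately have "integral {0..T} (\<lambda>t. G t * G t) = 0" by simp
    moreover have "continuous_on {0..T} (\<lambda>t. G t * G t)" by (intro continuous_intros contG)
    ultimately have "\<forall>t\<in>{0..T}. G t * G t = 0"
      using integral_eq_0_iff[of 0 T "\<lambda>t. G t * G t"] t by simp
    then show ?thesis using s by (simp add: G_def)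
  qed
  obtain n :: nat where n: "(\<bar>a\<bar> + 1) * t < real n" using reals_Archimedean2 by blast
  define k where "k = (pi / 2 + 2 * real n * pi) / t"
  have "(\<bar>a\<bar> + 1) * t < pi / 2 + 2 * real n * pi"
  proof -
    have "real n * 1 \<le> real n * (2 * pi)" using pi_ge_two by (intro mult_left_mono) auto
    then have "real n \<le> 2 * real n * pi" by (simp only: mult_ac mult_1_right)
    then show ?thesis using n pi_gt_zero by linarith
  qed
  then have "\<bar>a\<bar> + 1 < k" unfolding k_def using t by (simp only: pos_less_divide_eq)
  then have "k > a" by linarith
  moreover have "sin (k * t) = 1"
  proof -
    have "k * t = pi / 2 + 2 * real n * pi" using t by (simp add: k_def)
    then show ?thesis by (simp only: sin_add) simp
  qed
  ultimately show "h t = 0" using hs[of k t] t by simp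
qed

section \<open>The Helmholtz equation in the half-space\<close>

text \<open>The derivatives are parameters, and continuity up to the boundary is demanded of them and not of
  the difference quotients of \<open>w\<close>: they stand for the continuous extensions to the closed half-space
  of the derivatives taken in the open one.\<close>
locale dirichlet_helmholtz =
  fixes w :: "'a::euclidean_space \<times> real \<Rightarrow> real"
    and wb wbb :: "'a \<Rightarrow> 'a \<times> real \<Rightarrow> real"
    and wt wtt :: "'a \<times> real \<Rightarrow> real"
  assumes cont_w: "continuous_on (UNIV \<times> {0..}) w"
    and cont_wb: "\<And>b. b \<in> Basis \<Longrightarrow> continuous_on (UNIV \<times> {0..}) (wb b)"
    and cont_wbb: "\<And>b. b \<in> Basis \<Longrightarrow> continuous_on (UNIV \<times> {0..}) (wbb b)"
    and cont_wt: "continuous_on (UNIV \<times> {0..}) wt"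
    and deriv_wb: "\<And>b t. b \<in> Basis \<Longrightarrow> t > 0 \<Longrightarrow> has_dir_deriv b (\<lambda>x. w (x, t)) (\<lambda>x. wb b (x, t))"
    and deriv_wbb: "\<And>b t. b \<in> Basis \<Longrightarrow> t > 0 \<Longrightarrow> has_dir_deriv b (\<lambda>x. wb b (x, t)) (\<lambda>x. wbb b (x, t))"
    and deriv_wt: "\<And>x t. t > 0 \<Longrightarrow> ((\<lambda>t. w (x, t)) has_real_derivative wt (x, t)) (at t)"
    and deriv_wtt: "\<And>x t. t > 0 \<Longrightarrow> ((\<lambda>t. wt (x, t)) has_real_derivative wtt (x, t)) (at t)"
    and helmholtz: "\<And>x t. t > 0 \<Longrightarrow> (\<Sum>b\<in>Basis. wbb b (x, t)) + wtt (x, t) + w (x, t) = 0"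
    and dirichlet: "\<And>x. w (x, 0) = 0"
    and bounded_strip: "\<And>T. T > 0 \<Longrightarrow> \<exists>C. \<forall>x. \<forall>t\<in>{0..T}. \<bar>w (x, t)\<bar> \<le> C"
begin

abbreviation sine_integral :: "real \<Rightarrow> real \<Rightarrow> ('a \<times> real \<Rightarrow> real) \<Rightarrow> 'a \<Rightarrow> real"
  where "sine_integral T k \<equiv> fibre_integral T (\<lambda>t. sin (k * t))"

lemma sine_integral_continuous: "continuous_on UNIV (sine_integral T k w)"
  by (intro continuous_on_fibre_integral cont_w continuous_intros)

lemma sine_integral_bounded:
  assumes "T > 0"
  shows "\<exists>C. \<forall>x. \<bar>sine_integral T k w x\<bar> \<le> C"
proof -
  obtain C where C: "\<And>x t. t \<in> {0..T} \<Longrightarrow> \<bar>w (x, t)\<bar> \<le> C"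
    using bounded_strip[OF assms] by blast
  have "norm (sine_integral T k w x) \<le> C * (T - 0)" for x
    unfolding fibre_integral_def
  proof (rule integral_bound)
    show "continuous_on {0..T} (\<lambda>t. w (x, t) * sin (k * t))"
      by (intro continuous_on_compose2[OF cont_w] continuous_intros) auto
    show "norm (w (x, t) * sin (k * t)) \<le> C" if "t \<in> {0..T}" for t
    proof -
      have "\<bar>w (x, t)\<bar> * \<bar>sin (k * t)\<bar> \<le> \<bar>w (x, t)\<bar> * 1"
        by (intro mult_left_mono) auto
      then show ?thesis using C[OF that, of x] by (simp add: abs_mult)
    qed
  qed (use assms in auto)
  then show ?thesis by auto
qed

lemma sine_integral_derivs:
  assumes "b \<in> Basis"
  shows "has_dir_deriv b (sine_integral T k w) (sine_integral T k (wb b))"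
    and "has_dir_deriv b (sine_integral T k (wb b)) (sine_integral T k (wbb b))"
  by (intro has_dir_deriv_fibre_integral cont_w cont_wb cont_wbb deriv_wb deriv_wbb assms
      continuous_intros; assumption)+

text \<open>The function \<open>w\<^sub>t sin(kt) - k w cos(kt)\<close> has derivative \<open>(w\<^sub>t\<^sub>t + k\<^sup>2w) sin(kt)\<close>, and the equation
  replaces \<open>w\<^sub>t\<^sub>t\<close> by \<open>-w\<close> minus the tangential Laplacian. It vanishes at \<open>t = 0\<close> by the Dirichlet
  condition and the zero of the sine, so \<open>w\<^sub>t\<close> on the boundary does not appear.\<close>
lemma laplacian_sine_integral:
  assumes T: "T > 0"
  shows "(\<Sum>b\<in>Basis. sine_integral T k (wbb b) x)
    = (k\<^sup>2 - 1) * sine_integral T k w x - (wt (x, T) * sin (k * T) - k * w (x, T) * cos (k * T))"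
proof -
  let ?F = "\<lambda>t. wt (x, t) * sin (k * t) - k * w (x, t) * cos (k * t)"
  let ?f = "\<lambda>t. (k\<^sup>2 - 1) * (w (x, t) * sin (k * t)) - (\<Sum>b\<in>Basis. wbb b (x, t) * sin (k * t))"
  have "(?f has_integral ?F T - ?F 0) {0..T}"
  proof (rule fundamental_theorem_of_calculus_interior)
    show "continuous_on {0..T} ?F"
      by (intro continuous_on_compose2[OF cont_w] continuous_on_compose2[OF cont_wt] continuous_intros) auto
    show "(?F has_vector_derivative ?f t) (at t)" if "t \<in> {0<..<T}" for t
    proof -
      have "(?F has_real_derivative wtt (x, t) * sin (k * t) + k\<^sup>2 * w (x, t) * sin (k * t)) (at t)"
        using that deriv_wt[of t x] deriv_wtt[of t x]
        by (auto intro!: derivative_eq_intros simp: power2_eq_square)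
      also have "wtt (x, t) = - w (x, t) - (\<Sum>b\<in>Basis. wbb b (x, t))"
        using helmholtz[of t x] that by simp
      also have "(- w (x, t) - (\<Sum>b\<in>Basis. wbb b (x, t))) * sin (k * t) + k\<^sup>2 * w (x, t) * sin (k * t) = ?f t"
        by (simp add: algebra_simps sum_distrib_left)
      finally show ?thesis by (simp add: has_real_derivative_iff_has_vector_derivative)
    qed
  qed (use T in simp)
  moreover have "(?f has_integral (k\<^sup>2 - 1) * sine_integral T k w x - (\<Sum>b\<in>Basis. sine_integral T k (wbb b) x)) {0..T}"
    unfolding fibre_integral_def
    by (intro has_integral_diff has_integral_mult_right has_integral_sum integrable_integral
        integrable_continuous_interval continuous_on_compose2[OF cont_w]
        continuous_on_compose2[OF cont_wbb] continuous_intros) auto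
  ultimately have "?F T - ?F 0
      = (k\<^sup>2 - 1) * sine_integral T k w x - (\<Sum>b\<in>Basis. sine_integral T k (wbb b) x)"
    by (rule has_integral_unique)
  then show ?thesis by (simp add: dirichlet)
qed

text \<open>Unique continuation from height \<open>T\<close>. Zero Cauchy data at \<open>T\<close> make every sine integral with
  \<open>k > 1\<close> a bounded solution of \<open>\<Delta>'V = (k\<^sup>2 - 1)V\<close>.\<close>
lemma vanishes_if_clamped:
  assumes T: "T > 0" and clamped: "\<And>x. w (x, T) = 0" "\<And>x. wt (x, T) = 0"
    and t: "0 < t" "t \<le> T"
  shows "w (x, t) = 0"
proof (rule sine_integrals_determine[of T "\<lambda>t. w (x, t)" 1])
  show "continuous_on {0..T} (\<lambda>t. w (x, t))"
    by (intro continuous_on_compose2[OF cont_w] continuous_intros) auto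
  fix k :: real assume k: "k > 1"
  obtain C where "\<And>x. \<bar>sine_integral T k w x\<bar> \<le> C"
    using sine_integral_bounded[OF T] by blast
  then have "sine_integral T k w x = 0"
  proof (rule bounded_screened_harmonic_eq_0[OF sine_integral_continuous _ sine_integral_derivs])
    show "(\<Sum>b\<in>Basis. sine_integral T k (wbb b) x) = (k\<^sup>2 - 1) * sine_integral T k w x" for x
      by (simp add: laplacian_sine_integral[OF T] clamped)
    show "k\<^sup>2 - 1 > 0" using k by (simp add: one_less_power)
  qed
  then show "integral {0..T} (\<lambda>t. w (x, t) * sin (k * t)) = 0"
    by (simp add: fibre_integral_def)
qed (use t in auto)

text \<open>At a multiple \<open>T\<close> of the period, the sine integral of frequency \<open>1\<close> has tangential Laplacian
  \<open>w(\<cdot>, T)\<close>, so it is a bounded subharmonic function and must be harmonic.\<close>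
lemma nonneg_slice_vanishes:
  assumes dim: "DIM('a) \<le> 2" and T: "T > 0" and period: "sin T = 0" "cos T = 1"
    and nonneg: "\<And>x. w (x, T) \<ge> 0"
  shows "w (x, T) = 0"
proof -
  obtain C where C: "\<And>x. \<bar>sine_integral T 1 w x\<bar> \<le> C"
    using sine_integral_bounded[OF T] by blast
  show ?thesis
  proof (rule bounded_subharmonic_imp_harmonic_dim_le_2[OF dim sine_integral_continuous _ sine_integral_derivs])
    show "sine_integral T 1 w x \<le> C" for x using abs_le_D1[OF C] .
    show "(\<Sum>b\<in>Basis. sine_integral T 1 (wbb b) x) = w (x, T)" for x
      using laplacian_sine_integral[OF T, of 1 x] period by simp
    show "continuous_on UNIV (\<lambda>x. w (x, T))"
      by (intro continuous_on_compose2[OF cont_w] continuous_intros) (use T in auto)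
  qed (use nonneg in auto)
qed

text \<open>At heights that are multiples of \<open>2\<pi>\<close> the lower bound is zero, and once \<open>w\<close> vanishes there the
  nonnegative function \<open>w + 1 - cos t\<close> has a minimum, which gives the second Cauchy datum.\<close>
theorem vanishes_of_lower_bound:
  assumes dim: "DIM('a) \<le> 2" and lower: "\<And>x t. t \<ge> 0 \<Longrightarrow> w (x, t) \<ge> cos t - 1"
    and t: "t > 0"
  shows "w (x, t) = 0"
proof -
  obtain n :: nat where n: "t < real n" using reals_Archimedean2 by blast
  define T where "T = 2 * real n * pi"
  have "real n * 1 \<le> real n * (2 * pi)" using pi_ge_two by (intro mult_left_mono) auto
  then have "real n \<le> T" by (simp only: T_def mult_ac mult_1_right)
  then have T: "t \<le> T" "T > 0" using n t by linarith+
  have period: "sin T = 0" "cos T = 1" by (simp_all add: T_def)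
  have w0: "w (y, T) = 0" for y
    using lower[of T] T period by (intro nonneg_slice_vanishes dim) auto
  have wt0: "wt (y, T) = 0" for y
  proof -
    have "((\<lambda>s. w (y, s) + 1 - cos s) has_real_derivative wt (y, T)) (at T)"
      using deriv_wt[OF T(2), of y] period by (auto intro!: derivative_eq_intros)
    then show ?thesis
    proof (rule DERIV_local_min[of _ _ _ T])
      show "\<forall>s. \<bar>T - s\<bar> < T \<longrightarrow> w (y, T) + 1 - cos T \<le> w (y, s) + 1 - cos s"
        using w0 period lower by (auto simp: algebra_simps)
    qed (use T in auto)
  qed
  show ?thesis by (rule vanishes_if_clamped[OF T(2) w0 wt0 t T(1)])
qed

end

section \<open>Rigidity of the cosine profile\<close>
lemma C2_closure_half_space_derivs:
  fixes u :: "'a::euclidean_space \<times> real \<Rightarrow> real"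
  assumes "C2_closure half_space u"
  obtains p q where "\<And>i. i \<in> Basis \<Longrightarrow> continuous_on (UNIV \<times> {0..}) (p i)"
    and "\<And>i. i \<in> Basis \<Longrightarrow> continuous_on (UNIV \<times> {0..}) (q i)"
    and "\<And>i x. i \<in> Basis \<Longrightarrow> x \<in> half_space \<Longrightarrow>
      ((\<lambda>s. u (x + s *\<^sub>R i)) has_real_derivative p i x) (at 0)"
    and "\<And>i x. i \<in> Basis \<Longrightarrow> x \<in> half_space \<Longrightarrow>
      ((\<lambda>s. p i (x + s *\<^sub>R i)) has_real_derivative q i x) (at 0)"
    and "\<And>x. x \<in> half_space \<Longrightarrow> laplacian u x = (\<Sum>i\<in>Basis. q i x)"
proof -
  have clos: "closure half_space = (UNIV \<times> {0..} :: ('a \<times> real) set)"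
    by (simp add: half_space_def closure_Times)
  have "open (half_space :: ('a \<times> real) set)"
    unfolding half_space_def by (intro open_Times) auto
  have "\<forall>i\<in>Basis. \<exists>g. continuous_on (UNIV \<times> {0..}) g \<and> (\<forall>x\<in>half_space. g x = partial i u x)"
    and "\<forall>i\<in>Basis. \<exists>g. continuous_on (UNIV \<times> {0..}) g \<and> (\<forall>x\<in>half_space. g x = partial i (partial i u) x)"
    using assms unfolding C2_closure_def extends_continuously_def clos by blast+
  then obtain p q where
    p: "\<And>i. i \<in> Basis \<Longrightarrow> continuous_on (UNIV \<times> {0..}) (p i)"
       "\<And>i x. i \<in> Basis \<Longrightarrow> x \<in> half_space \<Longrightarrow> p i x = partial i u x" and
    q: "\<And>i. i \<in> Basis \<Longrightarrow> continuous_on (UNIV \<times> {0..}) (q i)"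
       "\<And>i x. i \<in> Basis \<Longrightarrow> x \<in> half_space \<Longrightarrow> q i x = partial i (partial i u) x"
    by (subst (asm) (1 2) bchoice_iff) blast
  have du: "((\<lambda>s. u (x + s *\<^sub>R i)) has_real_derivative p i x) (at 0)"
    if "i \<in> Basis" "x \<in> half_space" for i x
    using assms that
    by (simp add: p C2_closure_def has_partials_on_def partial_def DERIV_deriv_iff_real_differentiable)
  have dp: "((\<lambda>s. p i (x + s *\<^sub>R i)) has_real_derivative q i x) (at 0)"
    if i: "i \<in> Basis" and x: "x \<in> half_space" for i x
  proof (rule has_field_derivative_transform_within_open)
    show "((\<lambda>s. partial i u (x + s *\<^sub>R i)) has_real_derivative q i x) (at 0)"
      using assms that
      by (simp add: q C2_closure_def has_partials_on_def partial_def[of i "partial i u"]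
          DERIV_deriv_iff_real_differentiable)
    show "open ((\<lambda>s. x + s *\<^sub>R i) -` half_space)"
      by (intro open_vimage \<open>open half_space\<close> continuous_intros)
  qed (use p i x in auto)
  show thesis
    using that[OF p(1) q(1) du dp] by (simp add: laplacian_def q)
qed

text \<open>The difference \<open>u - (1 - cos t)\<close> satisfies the assumptions of the preceding section; the lower
  bound required there is the hypothesis \<open>u \<ge> 0\<close>.\<close>
theorem half_space_cosine_rigidity:
  fixes u :: "'a::euclidean_space \<times> real \<Rightarrow> real"
  assumes dim: "DIM('a) \<le> 2"
    and reg: "C2_closure half_space u"
    and pde: "\<And>x. x \<in> half_space \<Longrightarrow> - laplacian u x = u x - 1"
    and bc: "\<And>x. u (x, 0) = 0"
    and nonneg: "\<And>x t. t \<ge> 0 \<Longrightarrow> u (x, t) \<ge> 0"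
    and bound: "\<And>M::real. M > 0 \<Longrightarrow> \<exists>C. \<forall>x. \<forall>t\<in>{0..M}. u (x, t) \<le> C"
    and t: "t \<ge> 0"
  shows "u (x, t) = 1 - cos t"
proof (cases "t = 0")
  case True then show ?thesis by (simp add: bc)
next
  case False
  obtain p q where p: "\<And>i. i \<in> Basis \<Longrightarrow> continuous_on (UNIV \<times> {0..}) (p i)"
    and q: "\<And>i. i \<in> Basis \<Longrightarrow> continuous_on (UNIV \<times> {0..}) (q i)"
    and du: "\<And>i x. i \<in> Basis \<Longrightarrow> x \<in> half_space \<Longrightarrow>
      ((\<lambda>s. u (x + s *\<^sub>R i)) has_real_derivative p i x) (at 0)"
    and dp: "\<And>i x. i \<in> Basis \<Longrightarrow> x \<in> half_space \<Longrightarrow>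
      ((\<lambda>s. p i (x + s *\<^sub>R i)) has_real_derivative q i x) (at 0)"
    and lap: "\<And>x. x \<in> half_space \<Longrightarrow> laplacian u x = (\<Sum>i\<in>Basis. q i x)"
    by (rule C2_closure_half_space_derivs[OF reg]) (rule that; assumption)
  let ?e = "(0, 1) :: 'a \<times> real"
  have e: "?e \<in> Basis" by (simp add: Basis_prod_def)
  have tang: "(b, 0) \<in> (Basis :: ('a \<times> real) set)" if "b \<in> Basis" for b
    using that by (simp add: Basis_prod_def)
  have normal: "((\<lambda>s. f (x, s)) has_real_derivative f' (x, s)) (at s)"
    if "\<And>y. y \<in> half_space \<Longrightarrow> ((\<lambda>s. f (y + s *\<^sub>R ?e)) has_real_derivative f' y) (at 0)" "s > 0"
    for f f' :: "'a \<times> real \<Rightarrow> real" and x s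
    using that(1)[of "(x, s)"] that(2) DERIV_shift[of "\<lambda>s. f (x, s)" "f' (x, s)" 0 s]
    by (simp add: half_space_def add.commute)
  interpret dirichlet_helmholtz "\<lambda>z. u z - (1 - cos (snd z))" "\<lambda>b. p (b, 0)" "\<lambda>b. q (b, 0)"
    "\<lambda>z. p ?e z - sin (snd z)" "\<lambda>z. q ?e z - cos (snd z)"
  proof
    have contu: "continuous_on (UNIV \<times> {0..}) u"
      using reg by (simp add: C2_closure_def half_space_def closure_Times)
    show "continuous_on (UNIV \<times> {0..}) (\<lambda>z. u z - (1 - cos (snd z)))"
      by (intro continuous_intros contu)
    show "continuous_on (UNIV \<times> {0..}) (\<lambda>z. p ?e z - sin (snd z))"
      by (intro continuous_intros p e)
    show "continuous_on (UNIV \<times> {0..}) (p (b, 0))" "continuous_on (UNIV \<times> {0..}) (q (b, 0))"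
      if "b \<in> Basis" for b by (intro p q tang that)+
    show "has_dir_deriv b (\<lambda>x. u (x, t) - (1 - cos (snd (x, t)))) (\<lambda>x. p (b, 0) (x, t))"
      if "b \<in> Basis" "t > 0" for b t
      unfolding has_dir_deriv_def using that(2) du[OF tang[OF that(1)], of "(_, t)"]
      by (auto intro!: derivative_eq_intros simp: half_space_def)
    show "has_dir_deriv b (\<lambda>x. p (b, 0) (x, t)) (\<lambda>x. q (b, 0) (x, t))"
      if "b \<in> Basis" "t > 0" for b t
      unfolding has_dir_deriv_def using that(2) dp[OF tang[OF that(1)], of "(_, t)"]
      by (simp add: half_space_def)
    show "((\<lambda>t. u (x, t) - (1 - cos (snd (x, t)))) has_real_derivative p ?e (x, t) - sin (snd (x, t))) (at t)"
      if "t > 0" for x t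
      using normal[OF du[OF e] that, of x] by (auto intro!: derivative_eq_intros)
    show "((\<lambda>t. p ?e (x, t) - sin (snd (x, t))) has_real_derivative q ?e (x, t) - cos (snd (x, t))) (at t)"
      if "t > 0" for x t
      using normal[OF dp[OF e] that, of x] by (auto intro!: derivative_eq_intros)
    show "(\<Sum>b\<in>Basis. q (b, 0) (x, t)) + (q ?e (x, t) - cos (snd (x, t)))
        + (u (x, t) - (1 - cos (snd (x, t)))) = 0" if "t > 0" for x t
    proof -
      have "(\<Sum>i\<in>Basis. q i (x, t)) = (\<Sum>b\<in>Basis. q (b, 0) (x, t)) + q ?e (x, t)"
        unfolding Basis_prod_def
        by (subst sum.union_disjoint) (auto simp: sum.reindex inj_on_def)
      then show ?thesis
        using pde[of "(x, t)"] lap[of "(x, t)"] that by (simp add: half_space_def)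
    qed
    show "u (x, 0) - (1 - cos (snd (x, 0))) = 0" for x by (simp add: bc)
    show "\<exists>C. \<forall>x. \<forall>t\<in>{0..T}. \<bar>u (x, t) - (1 - cos (snd (x, t)))\<bar> \<le> C" if T: "T > 0" for T
    proof -
      obtain C where C: "\<And>x t. t \<in> {0..T} \<Longrightarrow> u (x, t) \<le> C" using bound[OF T] by blast
      have "\<bar>u (x, t) - (1 - cos t)\<bar> \<le> C + 2" if "t \<in> {0..T}" for x t
      proof -
        have "0 \<le> u (x, t)" using nonneg that by simp
        then show ?thesis
          using C[OF that, of x] cos_ge_minus_one[of t] cos_le_one[of t] by linarith
      qed
      then show ?thesis by (intro exI[of _ "C + 2"]) auto
    qed
  qed
  have "u (x, t) - (1 - cos (snd (x, t))) = 0"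
    using False t by (intro vanishes_of_lower_bound dim) (use nonneg in auto)
  then show ?thesis by simp
qed

theorem theorem1p1:
  fixes N :: nat
    and u :: "(real ^ 'm) \<times> real \<Rightarrow> real"
  assumes N: "N = 2 \<or> N = 3"
    and dim: "CARD('m) = N - 1"
    and reg: "C2_closure half_space u"
    and pde: "\<And>x. x \<in> half_space \<Longrightarrow> - laplacian u x = u x - 1"
    and bc: "\<And>x. x \<in> frontier half_space \<Longrightarrow> u x = 0"
    and bound: "\<And>M::real. M > 0 \<Longrightarrow>
      \<exists>C>0. \<forall>x \<in> UNIV \<times> {0..M}. 0 \<le> u x \<and> u x \<le> C"
  shows "\<forall>x'. \<forall>x\<^sub>N\<ge>0. u (x', x\<^sub>N) = 1 - cos x\<^sub>N"
proof (intro allI impI)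
  fix x' :: "real ^ 'm" and x\<^sub>N :: real
  assume "x\<^sub>N \<ge> 0"
  show "u (x', x\<^sub>N) = 1 - cos x\<^sub>N"
  proof (rule half_space_cosine_rigidity[OF _ reg pde _ _ _ \<open>x\<^sub>N \<ge> 0\<close>])
    show "DIM(real ^ 'm) \<le> 2" using N dim by auto
    show "u (x, 0) = 0" for x
    proof (rule bc)
      have "interior half_space = (half_space :: ((real ^ 'm) \<times> real) set)"
        unfolding half_space_def by (intro interior_open open_Times) auto
      then show "(x, 0) \<in> frontier half_space"
        by (simp add: frontier_def) (simp add: half_space_def closure_Times)
    qed
    show "u (x, t) \<ge> 0" if "t \<ge> 0" for x t
      using bound[of "t + 1"] that by force
    show "\<exists>C. \<forall>x. \<forall>t\<in>{0..M}. u (x, t) \<le> C" if "M > 0" for M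
      using bound[OF that] by force
  qed
qed

end
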